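(* Let $\nabla$ be an $h$-connection of $E$ and $\varepsilon\in\{+,-\}$. Suppose that the generators $C_{\varepsilon,1},C_{\varepsilon,2}$ of $G_{\hat\nabla,\varepsilon}$ are of order two and do not commute. If $\phi_\varepsilon\in(0,\pi/2)$ is represented as $q\pi$ for a rational number $q$, then $G_{\hat\nabla,\varepsilon}$ is finite; if $\phi_\varepsilon$ is represented as $\psi\pi$ for an irrational number $\psi$, then $G_{\hat\nabla,\varepsilon}$ is conjugate to a subgroup of $SO(3)$ generated by an element of order $2$ and an element of infinite order whose rotation axes are orthogonal, and therefore $G_{\hat\nabla,\varepsilon}$ is infinite but not dense in $SO(3)$.
   Context: Let $T^2=S^1\times S^1$ with $S^1=\mathbb{R}/2\pi\mathbb{Z}$ and let $\mathrm{pr}:\mathbb{R}^2\to T^2$ be the projection. $E$ is an oriented real vector bundle of rank 4 over $T^2$ with a positive-definite metric $h$. An $h$-connection is a connection $\nabla$ of $E$ with $\nabla h=0$. $\bigwedge^2E$ with the induced metric $\hat h$ decomposes into rank 3 subbundles $\bigwedge^2_+E\oplus\bigwedge^2_-E$: for a local positively oriented orthonormal frame $(e_1,e_2,e_3,e_4)$ of $E$, $\bigwedge^2_\pm E$ has the local orthonormal frame $\Omega_{\pm,1}=\frac1{\sqrt2}(e_1\wedge e_2\pm e_3\wedge e_4)$, $\Omega_{\pm,2}=\frac1{\sqrt2}(e_1\wedge e_3\pm e_4\wedge e_2)$, $\Omega_{\pm,3}=\frac1{\sqrt2}(e_1\wedge e_4\pm e_2\wedge e_3)$, and is oriented by it.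 $\nabla$ induces an $\hat h$-connection $\hat\nabla$ of $\bigwedge^2E$, which restricts to $\bigwedge^2_\pm E$. For $\varepsilon\in\{+,-\}$ fix a positively oriented orthonormal basis $(\omega_{\varepsilon,1},\omega_{\varepsilon,2},\omega_{\varepsilon,3})$ of the fiber of $\bigwedge^2_\varepsilon E$ at $\mathrm{pr}(0,0)$. Let $\tilde\Omega_{\varepsilon,i,x}$ (resp. $\tilde\Omega_{\varepsilon,i,y}$) be the $\hat\nabla$-parallel sections of $\mathrm{pr}^*\bigwedge^2_\varepsilon E$ along the $x$-axis (resp. $y$-axis) with value $\omega_{\varepsilon,i}$ at $(0,0)$. Identifying the fibers of the pull-back at $(x+2\pi m,y+2\pi n)$ and $(x,y)$ for $m,n\in\mathbb{Z}$, there are $C_{\varepsilon,1},C_{\varepsilon,2}\in SO(3)$ such that for all $a,b\in\mathbb{R}$: $(\tilde\Omega_{\varepsilon,i,x}(a+2\pi,0))_{i=1,2,3}=(\tilde\Omega_{\varepsilon,i,x}(a,0))_{i=1,2,3}\,C_{\varepsilon,1}$ and $(\tilde\Omega_{\varepsilon,i,y}(0,b+2\pi))_{i=1,2,3}=(\tilde\Omega_{\varepsilon,i,y}(0,b))_{i=1,2,3}\,C_{\varepsilon,2}$ (row vectors times matrices). The topological holonomy group $G_{\hat\nabla,\varepsilon}$ is the subgroup of $SO(3)$ generated by $C_{\varepsilon,1},C_{\varepsilon,2}$. For $C_{\varepsilon,1},C_{\varepsilon,2}$ different from the identity, $\phi_\varepsilon\in[0,\pi/2]$ denotes the angle between their rotation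 axes; the rotation axis of a non-identity element of $SO(3)$ is its eigenspace for the eigenvalue $1$. *)

theory Defs
  imports
    "HOL-Analysis.Analysis"
    "HOL-Library.Numeral_Type"
    "HOL-Algebra.Generated_Groups"
    "HOL-Algebra.Multiplicative_Group"
begin

section \<open>The torus and smooth functions on it\<close>

lemma equivp_circle: "equivp (\<lambda>x y :: real. \<exists>k::int. x - y = 2 * pi * of_int k)"
proof (rule equivpI)
  show "reflp (\<lambda>x y :: real. \<exists>k::int. x - y = 2 * pi * of_int k)"
    by (rule reflpI) (auto intro: exI[of _ "0::int"])
  show "symp (\<lambda>x y :: real. \<exists>k::int. x - y = 2 * pi * of_int k)"
  proof (rule sympI)
    fix x y :: real
    assume "\<exists>k::int. x - y = 2 * pi * of_int k"
    then obtain k :: int where "x - y = 2 * pi * of_int k" by blast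
    then have "y - x = 2 * pi * of_int (- k)" by simp
    then show "\<exists>k::int. y - x = 2 * pi * of_int k" by blast
  qed
  show "transp (\<lambda>x y :: real. \<exists>k::int. x - y = 2 * pi * of_int k)"
  proof (rule transpI)
    fix x y z :: real
    assume "\<exists>k::int. x - y = 2 * pi * of_int k" "\<exists>k::int. y - z = 2 * pi * of_int k"
    then obtain k l :: int where "x - y = 2 * pi * of_int k" "y - z = 2 * pi * of_int l" by blast
    then have "x - z = 2 * pi * of_int (k + l)" by (simp add: algebra_simps)
    then show "\<exists>k::int. x - z = 2 * pi * of_int k" by blast
  qed
qed

quotient_type circle = real / "\<lambda>x y :: real. \<exists>k::int. x - y = 2 * pi * of_int k"
  by (rule equivp_circle)

type_synonym torus = "circle \<times> circle"

definition pr :: "real \<times> real \<Rightarrow> torus" where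
  "pr z = (abs_circle (fst z), abs_circle (snd z))"

lemma pr_eq_iff:
  "pr z = pr w \<longleftrightarrow>
     (\<exists>m n :: int. z = w + (2 * pi * of_int m, 2 * pi * of_int n))"
proof -
  have "abs_circle x = abs_circle y \<longleftrightarrow> (\<exists>k::int. x = y + 2 * pi * of_int k)" for x y
    by (simp add: circle.abs_eq_iff algebra_simps)
  then show ?thesis
    by (auto simp: pr_def prod_eq_iff)
qed

text \<open>The quotient topology of \<open>\<real>\<^sup>2\<close>.\<close>

definition open_torus :: "torus set \<Rightarrow> bool" where
  "open_torus U \<longleftrightarrow> open (pr -` U)"

primrec Ck_on :: "nat \<Rightarrow> 'a set \<Rightarrow> ('a::real_normed_vector \<Rightarrow> 'b::real_normed_vector) \<Rightarrow> bool" where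
  "Ck_on 0 S f \<longleftrightarrow> continuous_on S f"
| "Ck_on (Suc k) S f \<longleftrightarrow>
     (\<forall>x\<in>S. f differentiable (at x)) \<and> (\<forall>v. Ck_on k S (\<lambda>x. frechet_derivative f (at x) v))"

text \<open>To be used on open sets only.\<close>

definition smooth_on :: "'a set \<Rightarrow> ('a::real_normed_vector \<Rightarrow> 'b::real_normed_vector) \<Rightarrow> bool" where
  "smooth_on S f \<longleftrightarrow> (\<forall>k. Ck_on k S f)"

definition smooth_on_torus :: "torus set \<Rightarrow> (torus \<Rightarrow> 'b::real_normed_vector) \<Rightarrow> bool" where
  "smooth_on_torus U f \<longleftrightarrow> smooth_on (pr -` U) (f \<circ> pr)"

text \<open>The differential of \<open>pr\<close> identifies every tangent space of the torus with \<open>\<real>\<^sup>2\<close>, so that a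
  vector field is a function into \<open>\<real>\<^sup>2\<close>; the constant functions \<open>(1, 0)\<close> and \<open>(0, 1)\<close> are the
  coordinate fields.\<close>

definition vector_fields :: "(torus \<Rightarrow> real \<times> real) set" where
  "vector_fields = {X. smooth_on_torus UNIV X}"

definition smooth_functions :: "(torus \<Rightarrow> real) set" where
  "smooth_functions = {f. smooth_on_torus UNIV f}"

text \<open>The derivative of \<open>f\<close> in the direction \<open>X\<close> at \<open>pr z\<close>. For differentiable \<open>f\<close> this depends
  on \<open>pr z\<close> only.\<close>

definition dir_deriv :: "(torus \<Rightarrow> real \<times> real) \<Rightarrow> (torus \<Rightarrow> real) \<Rightarrow> real \<times> real \<Rightarrow> real" where
  "dir_deriv X f z = frechet_derivative (f \<circ> pr) (at z) (X (pr z))"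

section \<open>Oriented metric vector bundles over the torus\<close>

text \<open>The fibers \<open>E p\<close> are linear subspaces of a real vector space \<open>'v\<close> without further structure.
  This is no restriction: given any bundle, take for \<open>'v\<close> the direct sum of its fibers. The total
  space is \<open>SIGMA p : UNIV. E p\<close>. A chart \<open>(U, \<phi>)\<close> is (the inverse of) a local trivialization,
  with \<open>\<phi> p\<close> a linear isomorphism from \<open>\<real>\<^sup>4\<close> to \<open>E p\<close> for \<open>p \<in> U\<close>. The orientation of the bundle is
  the one that makes all \<open>\<phi> p\<close> orientation preserving.\<close>

type_synonym 'v chart = "torus set \<times> (torus \<Rightarrow> real^4 \<Rightarrow> 'v)"

definition coords :: "(torus \<Rightarrow> real^4 \<Rightarrow> 'v) \<Rightarrow> torus \<Rightarrow> 'v \<Rightarrow> real^4" where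
  "coords \<phi> p v = inv_into UNIV (\<phi> p) v"

definition oriented_vector_bundle ::
  "(torus \<Rightarrow> 'v::real_vector set) \<Rightarrow> 'v chart set \<Rightarrow> bool" where
  "oriented_vector_bundle E \<A> \<longleftrightarrow>
     (\<forall>(U, \<phi>)\<in>\<A>. open_torus U \<and>
        (\<forall>p\<in>U. linear (\<phi> p) \<and> bij_betw (\<phi> p) UNIV (E p))) \<and>
     (\<Union>(U, \<phi>)\<in>\<A>. U) = UNIV \<and>
     (\<forall>(U, \<phi>)\<in>\<A>. \<forall>(W, \<psi>)\<in>\<A>.
        smooth_on_torus (U \<inter> W) (\<lambda>p. matrix (\<lambda>a. coords \<phi> p (\<psi> p a))) \<and>
        (\<forall>p\<in>U \<inter> W. det (matrix (\<lambda>a. coords \<phi> p (\<psi> p a))) > 0))"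

definition sections ::
  "(torus \<Rightarrow> 'v::real_vector set) \<Rightarrow> 'v chart set \<Rightarrow> (torus \<Rightarrow> 'v) set" where
  "sections E \<A> =
     {s. (\<forall>p. s p \<in> E p) \<and> (\<forall>(U, \<phi>)\<in>\<A>. smooth_on_torus U (\<lambda>p. coords \<phi> p (s p)))}"

definition bilinear_form_on :: "'v::real_vector set \<Rightarrow> ('v \<Rightarrow> 'v \<Rightarrow> real) \<Rightarrow> bool" where
  "bilinear_form_on V g \<longleftrightarrow>
     (\<forall>u\<in>V. \<forall>v\<in>V. \<forall>w\<in>V. g (u + v) w = g u w + g v w \<and> g w (u + v) = g w u + g w v) \<and>
     (\<forall>c. \<forall>u\<in>V. \<forall>w\<in>V. g (c *\<^sub>R u) w = c * g u w \<and> g w (c *\<^sub>R u) = c * g w u)"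

definition bundle_metric ::
  "(torus \<Rightarrow> 'v::real_vector set) \<Rightarrow> 'v chart set \<Rightarrow> (torus \<Rightarrow> 'v \<Rightarrow> 'v \<Rightarrow> real) \<Rightarrow> bool" where
  "bundle_metric E \<A> h \<longleftrightarrow>
     (\<forall>p. bilinear_form_on (E p) (h p) \<and>
        (\<forall>u\<in>E p. \<forall>v\<in>E p. h p u v = h p v u) \<and>
        (\<forall>u\<in>E p. u \<noteq> 0 \<longrightarrow> h p u u > 0)) \<and>
     (\<forall>(U, \<phi>)\<in>\<A>. \<forall>a b. smooth_on_torus U (\<lambda>p. h p (\<phi> p a) (\<phi> p b)))"

definition pos_orthonormal_basis ::
  "(torus \<Rightarrow> 'v::real_vector set) \<Rightarrow> 'v chart set \<Rightarrow> (torus \<Rightarrow> 'v \<Rightarrow> 'v \<Rightarrow> real) \<Rightarrow>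
   torus \<Rightarrow> 'v^4 \<Rightarrow> bool" where
  "pos_orthonormal_basis E \<A> h p e \<longleftrightarrow>
     (\<forall>i. e $ i \<in> E p) \<and>
     (\<forall>i j. h p (e $ i) (e $ j) = (if i = j then 1 else 0)) \<and>
     (\<exists>(U, \<phi>)\<in>\<A>. p \<in> U \<and> det (\<chi> i j. coords \<phi> p (e $ j) $ i) > 0)"

section \<open>Connections\<close>

text \<open>\<open>\<Gamma>\<close> is the space of smooth sections of a vector bundle, a module over the smooth functions.\<close>

definition connection ::
  "(torus \<Rightarrow> 'w::real_vector) set \<Rightarrow>
   ((torus \<Rightarrow> real \<times> real) \<Rightarrow> (torus \<Rightarrow> 'w) \<Rightarrow> (torus \<Rightarrow> 'w)) \<Rightarrow> bool" where
  "connection \<Gamma> D \<longleftrightarrow>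
     (\<forall>X\<in>vector_fields. \<forall>s\<in>\<Gamma>. D X s \<in> \<Gamma>) \<and>
     (\<forall>X\<in>vector_fields. \<forall>Y\<in>vector_fields. \<forall>s\<in>\<Gamma>. \<forall>p.
        D (\<lambda>q. X q + Y q) s p = D X s p + D Y s p) \<and>
     (\<forall>f\<in>smooth_functions. \<forall>X\<in>vector_fields. \<forall>s\<in>\<Gamma>. \<forall>p.
        D (\<lambda>q. f q *\<^sub>R X q) s p = f p *\<^sub>R D X s p) \<and>
     (\<forall>X\<in>vector_fields. \<forall>s\<in>\<Gamma>. \<forall>t\<in>\<Gamma>. \<forall>p.
        D X (\<lambda>q. s q + t q) p = D X s p + D X t p) \<and>
     (\<forall>f\<in>smooth_functions. \<forall>X\<in>vector_fields. \<forall>s\<in>\<Gamma>. \<forall>z.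
        D X (\<lambda>q. f q *\<^sub>R s q) (pr z) =
          dir_deriv X f z *\<^sub>R s (pr z) + f (pr z) *\<^sub>R D X s (pr z))"

definition h_connection ::
  "(torus \<Rightarrow> 'v::real_vector set) \<Rightarrow> 'v chart set \<Rightarrow> (torus \<Rightarrow> 'v \<Rightarrow> 'v \<Rightarrow> real) \<Rightarrow>
   ((torus \<Rightarrow> real \<times> real) \<Rightarrow> (torus \<Rightarrow> 'v) \<Rightarrow> (torus \<Rightarrow> 'v)) \<Rightarrow> bool" where
  "h_connection E \<A> h D \<longleftrightarrow>
     connection (sections E \<A>) D \<and>
     (\<forall>X\<in>vector_fields. \<forall>s\<in>sections E \<A>. \<forall>t\<in>sections E \<A>. \<forall>z.
        dir_deriv X (\<lambda>q. h q (s q) (t q)) z =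
          h (pr z) (D X s (pr z)) (t (pr z)) + h (pr z) (s (pr z)) (D X t (pr z)))"

text \<open>A section \<open>s\<close> of the pull-back of a bundle along the line \<open>t \<mapsto> t v\<close> is locally
  \<open>s t = \<Sum>\<^sub>k f\<^sub>k(t) e\<^sub>k(pr(t v))\<close> with smooth sections \<open>e\<^sub>k\<close> of the bundle, and the derivative of \<open>s\<close>
  for the pull-back connection is \<open>\<Sum>\<^sub>k f\<^sub>k'(t) e\<^sub>k + f\<^sub>k(t) D\<^sub>v e\<^sub>k\<close>, evaluated at \<open>pr(t v)\<close>, for any
  such representation.\<close>

definition parallel_along_line ::
  "(torus \<Rightarrow> 'w::real_vector) set \<Rightarrow>
   ((torus \<Rightarrow> real \<times> real) \<Rightarrow> (torus \<Rightarrow> 'w) \<Rightarrow> (torus \<Rightarrow> 'w)) \<Rightarrow>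
   real \<times> real \<Rightarrow> (real \<Rightarrow> 'w) \<Rightarrow> bool" where
  "parallel_along_line \<Gamma> D v s \<longleftrightarrow>
     (\<forall>t\<^sub>0. \<exists>I (n::nat) f e.
        open I \<and> t\<^sub>0 \<in> I \<and>
        (\<forall>k<n. smooth_on I (f k) \<and> e k \<in> \<Gamma>) \<and>
        (\<forall>t\<in>I.
           s t = (\<Sum>k<n. f k t *\<^sub>R e k (pr (t *\<^sub>R v))) \<and>
           (\<Sum>k<n. deriv (f k) t *\<^sub>R e k (pr (t *\<^sub>R v)) +
                  f k t *\<^sub>R D (\<lambda>_. v) (e k) (pr (t *\<^sub>R v))) = 0))"

section \<open>The exterior square\<close>

definition alternating_form :: "('v::real_vector \<Rightarrow> 'v \<Rightarrow> real) \<Rightarrow> bool" where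
  "alternating_form B \<longleftrightarrow> bilinear_form_on UNIV B \<and> (\<forall>v. B v v = 0)"

text \<open>The exterior square of \<open>'v\<close>, realised in the dual of the space of alternating bilinear forms:
  \<open>u \<and> v\<close> is the evaluation \<open>B \<mapsto> B u v\<close>, and every element is a finite sum of such.\<close>

definition eval_pairs :: "('v \<times> 'v) list \<Rightarrow> ('v::real_vector \<Rightarrow> 'v \<Rightarrow> real) \<Rightarrow> real" where
  "eval_pairs l B = (if alternating_form B then (\<Sum>(u, v)\<leftarrow>l. B u v) else 0)"

typedef (overloaded) ('v::real_vector) bivector = "range (eval_pairs :: ('v \<times> 'v) list \<Rightarrow> _)"
  by blast

lemma eval_pairs_append: "eval_pairs (l @ m) B = eval_pairs l B + eval_pairs m B"
  by (simp add: eval_pairs_def)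

lemma eval_pairs_scale:
  "eval_pairs (map (\<lambda>(u, v). (c *\<^sub>R u, v)) l) B = c * eval_pairs l B"
proof (cases "alternating_form B")
  case True
  then have "B (c *\<^sub>R u) v = c * B u v" for u v
    by (simp add: alternating_form_def bilinear_form_on_def)
  then have "(\<Sum>(u, v)\<leftarrow>map (\<lambda>(u, v). (c *\<^sub>R u, v)) l. B u v) = c * (\<Sum>(u, v)\<leftarrow>l. B u v)"
    by (induction l) (auto simp: algebra_simps)
  with True show ?thesis by (simp add: eval_pairs_def)
qed (simp add: eval_pairs_def)

setup_lifting type_definition_bivector

instantiation bivector :: (real_vector) real_vector
begin

lift_definition zero_bivector :: "'a bivector" is "\<lambda>_. 0"
  by (rule range_eqI[of _ _ "[]"]) (simp add: eval_pairs_def fun_eq_iff)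

lift_definition plus_bivector :: "'a bivector \<Rightarrow> 'a bivector \<Rightarrow> 'a bivector"
  is "\<lambda>F G B. F B + G B"
proof -
  fix F G :: "('a \<Rightarrow> 'a \<Rightarrow> real) \<Rightarrow> real"
  assume "F \<in> range eval_pairs" "G \<in> range eval_pairs"
  then obtain l m where "F = eval_pairs l" "G = eval_pairs m" by blast
  then have "(\<lambda>B. F B + G B) = eval_pairs (l @ m)" by (simp add: eval_pairs_append fun_eq_iff)
  then show "(\<lambda>B. F B + G B) \<in> range eval_pairs" by blast
qed

lift_definition scaleR_bivector :: "real \<Rightarrow> 'a bivector \<Rightarrow> 'a bivector"
  is "\<lambda>c F B. c * F B"
proof -
  fix c and F :: "('a \<Rightarrow> 'a \<Rightarrow> real) \<Rightarrow> real"
  assume "F \<in> range eval_pairs"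
  then obtain l where "F = eval_pairs l" by blast
  then have "(\<lambda>B. c * F B) = eval_pairs (map (\<lambda>(u, v). (c *\<^sub>R u, v)) l)"
    by (simp add: eval_pairs_scale fun_eq_iff)
  then show "(\<lambda>B. c * F B) \<in> range eval_pairs" by blast
qed

definition uminus_bivector :: "'a bivector \<Rightarrow> 'a bivector" where
  "uminus_bivector F = (- 1) *\<^sub>R F"

definition minus_bivector :: "'a bivector \<Rightarrow> 'a bivector \<Rightarrow> 'a bivector" where
  "minus_bivector F G = F + - G"

instance
proof
  fix a b :: real and F G H :: "'a bivector"
  show "F + G + H = F + (G + H)" by transfer (simp add: fun_eq_iff)
  show "F + G = G + F" by transfer (simp add: fun_eq_iff)
  show "0 + F = F" by transfer simp
  show "- F + F = 0" unfolding uminus_bivector_def by transfer simp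
  show "F - G = F + - G" by (rule minus_bivector_def)
  show "a *\<^sub>R (F + G) = a *\<^sub>R F + a *\<^sub>R G" by transfer (simp add: fun_eq_iff algebra_simps)
  show "(a + b) *\<^sub>R F = a *\<^sub>R F + b *\<^sub>R F" by transfer (simp add: fun_eq_iff algebra_simps)
  show "a *\<^sub>R b *\<^sub>R F = (a * b) *\<^sub>R F" by transfer (simp add: fun_eq_iff algebra_simps)
  show "1 *\<^sub>R F = F" by transfer simp
qed

end

lift_definition wedge :: "'v::real_vector \<Rightarrow> 'v \<Rightarrow> 'v bivector" (infixl "\<and>\<and>" 70)
  is "\<lambda>u v. eval_pairs [(u, v)]"
  by blast

lemma wedge_add_left: "(u + v) \<and>\<and> w = u \<and>\<and> w + v \<and>\<and> w"
  by transfer (auto simp: eval_pairs_def fun_eq_iff alternating_form_def bilinear_form_on_def)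

lemma wedge_add_right: "w \<and>\<and> (u + v) = w \<and>\<and> u + w \<and>\<and> v"
  by transfer (auto simp: eval_pairs_def fun_eq_iff alternating_form_def bilinear_form_on_def)

lemma wedge_scaleR_left: "(c *\<^sub>R u) \<and>\<and> w = c *\<^sub>R (u \<and>\<and> w)"
  by transfer (auto simp: eval_pairs_def fun_eq_iff alternating_form_def bilinear_form_on_def)

lemma wedge_scaleR_right: "w \<and>\<and> (c *\<^sub>R u) = c *\<^sub>R (w \<and>\<and> u)"
  by transfer (auto simp: eval_pairs_def fun_eq_iff alternating_form_def bilinear_form_on_def)

lemma wedge_self: "u \<and>\<and> u = 0"
  by transfer (auto simp: eval_pairs_def fun_eq_iff alternating_form_def)

definition ext2 :: "'v::real_vector set \<Rightarrow> 'v bivector set" where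
  "ext2 V = span {u \<and>\<and> v | u v. u \<in> V \<and> v \<in> V}"

text \<open>\<open>G\<close> is the metric on the exterior square of \<open>V\<close> that is induced by \<open>g\<close>; it is determined on
  \<open>ext2 V\<close> by these conditions.\<close>

definition ext2_metric ::
  "'v::real_vector set \<Rightarrow> ('v \<Rightarrow> 'v \<Rightarrow> real) \<Rightarrow> ('v bivector \<Rightarrow> 'v bivector \<Rightarrow> real) \<Rightarrow> bool" where
  "ext2_metric V g G \<longleftrightarrow>
     bilinear_form_on (ext2 V) G \<and>
     (\<forall>u\<^sub>1\<in>V. \<forall>u\<^sub>2\<in>V. \<forall>v\<^sub>1\<in>V. \<forall>v\<^sub>2\<in>V.
        G (u\<^sub>1 \<and>\<and> u\<^sub>2) (v\<^sub>1 \<and>\<and> v\<^sub>2) = g u\<^sub>1 v\<^sub>1 * g u\<^sub>2 v\<^sub>2 - g u\<^sub>1 v\<^sub>2 * g u\<^sub>2 v\<^sub>1)"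

definition ext2_sections ::
  "(torus \<Rightarrow> 'v::real_vector set) \<Rightarrow> 'v chart set \<Rightarrow> (torus \<Rightarrow> 'v bivector) set" where
  "ext2_sections E \<A> =
     {w. (\<forall>p. w p \<in> ext2 (E p)) \<and>
         (\<forall>(U, \<phi>)\<in>\<A>. \<exists>c :: torus \<Rightarrow> real^4^4. smooth_on_torus U c \<and>
            (\<forall>p\<in>U. w p =
               (\<Sum>i\<in>UNIV. \<Sum>j\<in>UNIV. c p $ i $ j *\<^sub>R (\<phi> p (axis i 1) \<and>\<and> \<phi> p (axis j 1)))))}"

definition ext2_connection ::
  "(torus \<Rightarrow> 'v::real_vector set) \<Rightarrow> 'v chart set \<Rightarrow>
   ((torus \<Rightarrow> real \<times> real) \<Rightarrow> (torus \<Rightarrow> 'v) \<Rightarrow> (torus \<Rightarrow> 'v)) \<Rightarrow>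
   ((torus \<Rightarrow> real \<times> real) \<Rightarrow> (torus \<Rightarrow> 'v bivector) \<Rightarrow> (torus \<Rightarrow> 'v bivector)) \<Rightarrow> bool" where
  "ext2_connection E \<A> D D2 \<longleftrightarrow>
     connection (ext2_sections E \<A>) D2 \<and>
     (\<forall>X\<in>vector_fields. \<forall>s\<in>sections E \<A>. \<forall>t\<in>sections E \<A>. \<forall>p.
        D2 X (\<lambda>q. s q \<and>\<and> t q) p = D X s p \<and>\<and> t p + s p \<and>\<and> D X t p)"

text \<open>The sign \<open>\<epsilon>\<close> is \<open>1\<close> or \<open>-1\<close>.\<close>

definition Omega :: "real \<Rightarrow> 'v::real_vector^4 \<Rightarrow> 'v bivector^3" where
  "Omega \<epsilon> e = vector
     [(1 / sqrt 2) *\<^sub>R (e $ 1 \<and>\<and> e $ 2 + \<epsilon> *\<^sub>R (e $ 3 \<and>\<and> e $ 4)),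
      (1 / sqrt 2) *\<^sub>R (e $ 1 \<and>\<and> e $ 3 + \<epsilon> *\<^sub>R (e $ 4 \<and>\<and> e $ 2)),
      (1 / sqrt 2) *\<^sub>R (e $ 1 \<and>\<and> e $ 4 + \<epsilon> *\<^sub>R (e $ 2 \<and>\<and> e $ 3))]"

text \<open>The fibers of the two rank 3 subbundles; the span is the same for all \<open>e\<close>.\<close>

definition ext2_part ::
  "real \<Rightarrow> (torus \<Rightarrow> 'v::real_vector set) \<Rightarrow> 'v chart set \<Rightarrow> (torus \<Rightarrow> 'v \<Rightarrow> 'v \<Rightarrow> real) \<Rightarrow>
   torus \<Rightarrow> 'v bivector set" where
  "ext2_part \<epsilon> E \<A> h p =
     {w. \<exists>e. pos_orthonormal_basis E \<A> h p e \<and> w \<in> span (range (\<lambda>i. Omega \<epsilon> e $ i))}"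

text \<open>A triple of vectors, read as a row, times a matrix.\<close>

definition frame_mult :: "'w::real_vector^3 \<Rightarrow> real^3^3 \<Rightarrow> 'w^3" (infixl "\<cdot>\<^sub>m" 70) where
  "\<omega> \<cdot>\<^sub>m C = (\<chi> i. \<Sum>j\<in>UNIV. C $ j $ i *\<^sub>R \<omega> $ j)"

definition pos_orthonormal_ext2_basis ::
  "real \<Rightarrow> (torus \<Rightarrow> 'v::real_vector set) \<Rightarrow> 'v chart set \<Rightarrow> (torus \<Rightarrow> 'v \<Rightarrow> 'v \<Rightarrow> real) \<Rightarrow>
   torus \<Rightarrow> 'v bivector^3 \<Rightarrow> bool" where
  "pos_orthonormal_ext2_basis \<epsilon> E \<A> h p \<omega> \<longleftrightarrow>
     (\<exists>G. ext2_metric (E p) (h p) G \<and>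
        (\<forall>i j. G (\<omega> $ i) (\<omega> $ j) = (if i = j then 1 else 0))) \<and>
     (\<exists>e P. pos_orthonormal_basis E \<A> h p e \<and> det P > 0 \<and> \<omega> = Omega \<epsilon> e \<cdot>\<^sub>m P)"

section \<open>The topological holonomy group\<close>

definition SO3 :: "(real^3^3) monoid" where
  "SO3 = \<lparr>carrier = {C. rotation_matrix C}, monoid.mult = (**), one = mat 1\<rparr>"

lemma group_SO3: "group SO3"
proof (rule groupI)
  fix A B C assume "A \<in> carrier SO3" "B \<in> carrier SO3" "C \<in> carrier SO3"
  then show "A \<otimes>\<^bsub>SO3\<^esub> B \<in> carrier SO3"
    by (simp add: SO3_def rotation_matrix_def orthogonal_matrix_mul det_mul)
  show "A \<otimes>\<^bsub>SO3\<^esub> B \<otimes>\<^bsub>SO3\<^esub> C = A \<otimes>\<^bsub>SO3\<^esub> (B \<otimes>\<^bsub>SO3\<^esub> C)"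
    by (simp add: SO3_def matrix_mul_assoc)
next
  fix C assume C: "C \<in> carrier SO3"
  show "\<one>\<^bsub>SO3\<^esub> \<otimes>\<^bsub>SO3\<^esub> C = C"
    by (simp add: SO3_def)
  from C have "transpose C \<in> carrier SO3" "transpose C \<otimes>\<^bsub>SO3\<^esub> C = \<one>\<^bsub>SO3\<^esub>"
    by (simp_all add: SO3_def rotation_matrix_def orthogonal_matrix_def det_transpose)
  then show "\<exists>B\<in>carrier SO3. B \<otimes>\<^bsub>SO3\<^esub> C = \<one>\<^bsub>SO3\<^esub>"
    by blast
qed (simp add: SO3_def rotation_matrix_def orthogonal_matrix_id)

text \<open>A section of the pull-back to \<open>\<real>\<^sup>2\<close> has at \<open>z\<close> a value in the fiber at \<open>pr z\<close>, so that the
  fibers at points that differ by an element of \<open>(2\<pi>\<int>)\<^sup>2\<close> are identified automatically.\<close>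

definition parallel_ext2_frame ::
  "real \<Rightarrow> (torus \<Rightarrow> 'v::real_vector set) \<Rightarrow> 'v chart set \<Rightarrow> (torus \<Rightarrow> 'v \<Rightarrow> 'v \<Rightarrow> real) \<Rightarrow>
   ((torus \<Rightarrow> real \<times> real) \<Rightarrow> (torus \<Rightarrow> 'v bivector) \<Rightarrow> (torus \<Rightarrow> 'v bivector)) \<Rightarrow>
   'v bivector^3 \<Rightarrow> real \<times> real \<Rightarrow> (real \<Rightarrow> 'v bivector^3) \<Rightarrow> bool" where
  "parallel_ext2_frame \<epsilon> E \<A> h D2 \<omega> v \<Omega> \<longleftrightarrow>
     \<Omega> 0 = \<omega> \<and>
     (\<forall>i. (\<forall>t. \<Omega> t $ i \<in> ext2_part \<epsilon> E \<A> h (pr (t *\<^sub>R v))) \<and>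
          parallel_along_line (ext2_sections E \<A>) D2 v (\<lambda>t. \<Omega> t $ i))"

definition holonomy_generators ::
  "real \<Rightarrow> (torus \<Rightarrow> 'v::real_vector set) \<Rightarrow> 'v chart set \<Rightarrow> (torus \<Rightarrow> 'v \<Rightarrow> 'v \<Rightarrow> real) \<Rightarrow>
   ((torus \<Rightarrow> real \<times> real) \<Rightarrow> (torus \<Rightarrow> 'v bivector) \<Rightarrow> (torus \<Rightarrow> 'v bivector)) \<Rightarrow>
   'v bivector^3 \<Rightarrow> real^3^3 \<Rightarrow> real^3^3 \<Rightarrow> bool" where
  "holonomy_generators \<epsilon> E \<A> h D2 \<omega> C\<^sub>1 C\<^sub>2 \<longleftrightarrow>
     C\<^sub>1 \<in> carrier SO3 \<and> C\<^sub>2 \<in> carrier SO3 \<and>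
     (\<exists>\<Omega>\<^sub>x \<Omega>\<^sub>y.
        parallel_ext2_frame \<epsilon> E \<A> h D2 \<omega> (1, 0) \<Omega>\<^sub>x \<and>
        parallel_ext2_frame \<epsilon> E \<A> h D2 \<omega> (0, 1) \<Omega>\<^sub>y \<and>
        (\<forall>a. \<Omega>\<^sub>x (a + 2 * pi) = \<Omega>\<^sub>x a \<cdot>\<^sub>m C\<^sub>1) \<and>
        (\<forall>b. \<Omega>\<^sub>y (b + 2 * pi) = \<Omega>\<^sub>y b \<cdot>\<^sub>m C\<^sub>2))"

definition holonomy_group :: "real^3^3 \<Rightarrow> real^3^3 \<Rightarrow> (real^3^3) set" where
  "holonomy_group C\<^sub>1 C\<^sub>2 = generate SO3 {C\<^sub>1, C\<^sub>2}"

section \<open>Rotation axes, conjugacy, density\<close>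

text \<open>Only meaningful for non-identity elements of \<open>SO(3)\<close>.\<close>

definition rotation_axis :: "real^3^3 \<Rightarrow> (real^3) set" where
  "rotation_axis C = {v. C *v v = v}"

text \<open>The angle in \<open>[0, \<pi>/2]\<close> between two lines through the origin.\<close>

definition line_angle :: "(real^3) set \<Rightarrow> (real^3) set \<Rightarrow> real" where
  "line_angle L M = (THE \<theta>. \<forall>u\<in>L - {0}. \<forall>v\<in>M - {0}.
     \<theta> = arccos (\<bar>u \<bullet> v\<bar> / (norm u * norm v)))"

lemma line_angle_span:
  assumes "u \<noteq> 0" "v \<noteq> 0"
  shows "line_angle (span {u}) (span {v}) = arccos (\<bar>u \<bullet> v\<bar> / (norm u * norm v))"
proof -
  have "arccos (\<bar>u' \<bullet> v'\<bar> / (norm u' * norm v')) = arccos (\<bar>u \<bullet> v\<bar> / (norm u * norm v))"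
    if "u' \<in> span {u} - {0}" "v' \<in> span {v} - {0}" for u' v'
  proof -
    from that obtain a b where "u' = a *\<^sub>R u" "v' = b *\<^sub>R v" "a \<noteq> 0" "b \<noteq> 0"
      by (auto simp: span_singleton)
    then show ?thesis by (simp add: abs_mult)
  qed
  note same = this
  have mem: "u \<in> span {u} - {0}" "v \<in> span {v} - {0}"
    using assms by (auto simp: span_base)
  show ?thesis
    unfolding line_angle_def
  proof (rule the_equality)
    show "\<forall>u'\<in>span {u} - {0}. \<forall>v'\<in>span {v} - {0}.
        arccos (\<bar>u \<bullet> v\<bar> / (norm u * norm v)) = arccos (\<bar>u' \<bullet> v'\<bar> / (norm u' * norm v'))"
      by (intro ballI same[symmetric])
  next
    fix \<theta>
    assume "\<forall>u'\<in>span {u} - {0}. \<forall>v'\<in>span {v} - {0}.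
        \<theta> = arccos (\<bar>u' \<bullet> v'\<bar> / (norm u' * norm v'))"
    from bspec[OF bspec[OF this mem(1)] mem(2)]
    show "\<theta> = arccos (\<bar>u \<bullet> v\<bar> / (norm u * norm v))" .
  qed
qed

definition order_two :: "real^3^3 \<Rightarrow> bool" where
  "order_two C \<longleftrightarrow> C \<in> carrier SO3 \<and> group.ord SO3 C = 2"

definition infinite_order :: "real^3^3 \<Rightarrow> bool" where
  "infinite_order C \<longleftrightarrow> C \<in> carrier SO3 \<and> (\<forall>n::nat. n > 0 \<longrightarrow> C [^]\<^bsub>SO3\<^esub> n \<noteq> \<one>\<^bsub>SO3\<^esub>)"

definition orthogonal_axes :: "real^3^3 \<Rightarrow> real^3^3 \<Rightarrow> bool" where
  "orthogonal_axes A B \<longleftrightarrow> (\<forall>u\<in>rotation_axis A. \<forall>v\<in>rotation_axis B. orthogonal u v)"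

definition conjugate_in_SO3 :: "(real^3^3) set \<Rightarrow> (real^3^3) set \<Rightarrow> bool" where
  "conjugate_in_SO3 G H \<longleftrightarrow>
     (\<exists>P\<in>carrier SO3. H = (\<lambda>C. P \<otimes>\<^bsub>SO3\<^esub> C \<otimes>\<^bsub>SO3\<^esub> inv\<^bsub>SO3\<^esub> P) ` G)"

definition dense_in_SO3 :: "(real^3^3) set \<Rightarrow> bool" where
  "dense_in_SO3 G \<longleftrightarrow> carrier SO3 \<subseteq> closure G"

end

theory Submission
  imports Defs
begin

text \<open>Both claims concern the subgroup of \<open>SO(3)\<close> generated by two non-commuting elements \<open>C\<^sub>1\<close> and
  \<open>C\<^sub>2\<close> of order two. Such elements are half-turns about lines \<open>\<real> u\<^sub>1\<close> and \<open>\<real> u\<^sub>2\<close>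
  (\<open>order_two_obtains_halfturn\<close>), and after a choice of signs the unit vectors \<open>u\<^sub>1\<close> and \<open>u\<^sub>2\<close> enclose
  the angle \<open>\<phi>\<close>. On the plane that they span, the half-turn about a line of the plane acts as the
  reflection in that line; on the normal of the plane it is \<open>-1\<close>. So the group is a dihedral group
  of symmetries of a plane.

  Let \<open>w \<theta>\<close> be the unit vector of the plane at angle \<open>\<theta>\<close> from \<open>u\<^sub>1\<close>, and \<open>H \<theta>\<close> the half-turn
  about it, so that \<open>C\<^sub>1 = H 0\<close> and \<open>C\<^sub>2 = H \<phi>\<close>. The law \<open>H \<alpha> H \<beta> H \<gamma> = H (\<alpha> - \<beta> + \<gamma>)\<close>
  (\<open>three_reflections\<close>) determines the group: each of its elements is \<open>H (k \<phi>)\<close> or \<open>H 0 H (k \<phi>)\<close>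
  for an integer \<open>k\<close> (\<open>dihedral_generate_subset\<close>), and \<open>(C\<^sub>1 C\<^sub>2)\<^sup>k = H 0 H (k \<phi>)\<close>
  (\<open>dihedral_rotation_pow\<close>). Since \<open>H\<close> has period \<open>\<pi>\<close>, there are finitely many such elements if \<open>\<phi>\<close>
  is a rational multiple of \<open>\<pi>\<close>. Since \<open>H \<theta> = H 0\<close> only for \<open>\<theta> \<in> \<pi>\<int>\<close>, the product \<open>C\<^sub>1 C\<^sub>2\<close> has
  infinite order if \<open>\<phi>\<close> is an irrational multiple of \<open>\<pi>\<close>.

  In the second case \<open>C\<^sub>1\<close> and \<open>C\<^sub>1 C\<^sub>2\<close> generate the same group as \<open>C\<^sub>1\<close> and \<open>C\<^sub>2\<close>, so that the identity
  serves as the conjugating element; and the axis of \<open>C\<^sub>1 C\<^sub>2\<close> is the normal of the plane, hence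
  orthogonal to \<open>u\<^sub>1\<close>. Every element of the group maps a normal vector of the plane to itself or to its
  negative. This is a closed condition that fails for some rotations, so the group is not dense.\<close>

section \<open>The group of rotations\<close>

lemma SO3_simps [simp]:
  "A \<otimes>\<^bsub>SO3\<^esub> B = A ** B" "\<one>\<^bsub>SO3\<^esub> = mat 1" "A \<in> carrier SO3 \<longleftrightarrow> rotation_matrix A"
  by (simp_all add: SO3_def)

lemma rotation_matrix_mult:
  fixes A B :: "real^'n^'n"
  assumes "rotation_matrix A" "rotation_matrix B"
  shows "rotation_matrix (A ** B)"
  using assms by (simp add: rotation_matrix_def orthogonal_matrix_mul det_mul)

lemma SO3_inv_involution:
  assumes "rotation_matrix A" "A ** A = mat 1"
  shows "inv\<^bsub>SO3\<^esub> A = A"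
  using assms by (intro group.inv_equality[OF group_SO3]) auto

lemma order_two_iff:
  "order_two C \<longleftrightarrow> rotation_matrix C \<and> C ** C = mat 1 \<and> C \<noteq> mat 1"
proof -
  interpret group SO3 by (rule group_SO3)
  have "ord C = 2 \<longleftrightarrow> C ** C = mat 1 \<and> C \<noteq> mat 1" if C: "C \<in> carrier SO3"
  proof
    assume o: "ord C = 2"
    have "C [^]\<^bsub>SO3\<^esub> (2::nat) = mat 1"
      using pow_ord_eq_1[OF C] o by simp
    moreover have "C \<noteq> mat 1"
      using ord_eq_1[OF C] o by auto
    ultimately show "C ** C = mat 1 \<and> C \<noteq> mat 1"
      using C by (simp add: numeral_2_eq_2)
  next
    assume a: "C ** C = mat 1 \<and> C \<noteq> mat 1"
    then have "C [^]\<^bsub>SO3\<^esub> (2::nat) = \<one>\<^bsub>SO3\<^esub>"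
      using C by (simp add: numeral_2_eq_2)
    then have "ord C dvd 2"
      using pow_eq_id[OF C] by blast
    then have "ord C = 1 \<or> ord C = 2"
      using two_is_prime_nat prime_nat_iff by blast
    then show "ord C = 2"
      using ord_eq_1[OF C] a by auto
  qed
  then show ?thesis
    by (auto simp: order_two_def)
qed

lemma generate_SO3_product_generator:
  assumes "rotation_matrix A" "rotation_matrix B"
  shows "generate SO3 {A, A ** B} = generate SO3 {A, B}"
proof -
  interpret group SO3 by (rule group_SO3)
  have AB: "A ** B \<in> generate SO3 {A, B}"
    using generate.eng[of A SO3 "{A, B}" B] by (auto intro: generate.incl)
  have "inv\<^bsub>SO3\<^esub> A \<otimes>\<^bsub>SO3\<^esub> (A \<otimes>\<^bsub>SO3\<^esub> B) = B"
    using assms by (intro inv_solve_left'[THEN iffD2])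
      (simp_all add: rotation_matrix_mult)
  then have B: "B \<in> generate SO3 {A, A ** B}"
    using generate.eng[of "inv\<^bsub>SO3\<^esub> A" SO3 "{A, A ** B}" "A ** B"]
    by (auto intro: generate.incl generate.inv)
  have "subgroup (generate SO3 {A, B}) SO3" "subgroup (generate SO3 {A, A ** B}) SO3"
    using assms by (auto intro!: generate_is_subgroup rotation_matrix_mult)
  then show ?thesis
    using AB B by (intro equalityI generate_subgroup_incl) (auto intro: generate.incl)
qed

lemma conjugate_in_SO3_refl:
  assumes "G \<subseteq> carrier SO3"
  shows "conjugate_in_SO3 G G"
proof -
  interpret group SO3 by (rule group_SO3)
  have "inv\<^bsub>SO3\<^esub> (mat 1) = mat 1"
    using inv_one by simp
  then show ?thesis
    unfolding conjugate_in_SO3_def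
    by (intro bexI[of _ "mat 1"]) (use one_closed in \<open>auto\<close>)
qed

lemma infinite_generate_infinite_order:
  assumes "infinite_order B" "B \<in> generate SO3 S" "S \<subseteq> carrier SO3"
  shows "infinite (generate SO3 S)"
proof
  interpret group SO3 by (rule group_SO3)
  assume fin: "finite (generate SO3 S)"
  have sub: "subgroup (generate SO3 S) SO3"
    using assms(3) by (rule generate_is_subgroup)
  have B: "B \<in> carrier SO3"
    using assms(1) by (simp add: infinite_order_def)
  have pow: "B [^]\<^bsub>SO3\<^esub> (n::nat) \<in> generate SO3 S" for n
    by (induction n) (use assms(2) sub in \<open>auto simp del: SO3_simps
        intro: subgroup.m_closed subgroup.one_closed\<close>)
  then have "finite (range (\<lambda>n::nat. B [^]\<^bsub>SO3\<^esub> n))"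
    by (intro finite_subset[OF _ fin]) auto
  then have "\<not> inj (\<lambda>n::nat. B [^]\<^bsub>SO3\<^esub> n)"
    by (meson finite_imageD infinite_UNIV_nat)
  then obtain m n :: nat where "m < n" "B [^]\<^bsub>SO3\<^esub> m = B [^]\<^bsub>SO3\<^esub> n"
    by (metis injI linorder_neqE_nat)
  then have "B [^]\<^bsub>SO3\<^esub> (n - m) = \<one>\<^bsub>SO3\<^esub>"
    using B pow_eq_div2 by metis
  with assms(1) \<open>m < n\<close> show False
    unfolding infinite_order_def by (metis zero_less_diff)
qed

section \<open>Half-turns\<close>

text \<open>The matrix \<open>2 u u\<^sup>T - 1\<close>, which for a unit vector \<open>u\<close> keeps the component along \<open>u\<close> and negates
  the orthogonal component.\<close>

definition halfturn :: "real^3 \<Rightarrow> real^3^3" where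
  "halfturn u = (\<chi> i j. 2 * u $ i * u $ j - (if i = j then 1 else 0))"

lemma halfturn_apply: "halfturn u *v x = (2 * (u \<bullet> x)) *\<^sub>R u - x"
  by (simp add: vec_eq_iff halfturn_def matrix_vector_mult_def inner_vec_def sum_3 forall_3
      algebra_simps)

lemma halfturn_minus [simp]: "halfturn (- u) = halfturn u"
  by (simp add: halfturn_def)

lemma halfturn_square:
  assumes "norm u = 1"
  shows "halfturn u ** halfturn u = mat 1"
  using assms
  by (simp add: matrix_eq matrix_vector_mul_assoc[symmetric] halfturn_apply inner_diff_right
      norm_eq_1)

lemma rotation_axis_halfturn:
  assumes "norm u = 1"
  shows "rotation_axis (halfturn u) = span {u}"
proof -
  have "halfturn u *v x = x \<longleftrightarrow> x = (u \<bullet> x) *\<^sub>R u" for x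
  proof -
    have "halfturn u *v x = x \<longleftrightarrow> 2 *\<^sub>R ((u \<bullet> x) *\<^sub>R u) = 2 *\<^sub>R x"
      by (simp add: halfturn_apply diff_eq_eq scaleR_2[of x])
    then show ?thesis by (metis scaleR_cancel_left zero_neq_numeral)
  qed
  moreover have "x = (u \<bullet> x) *\<^sub>R u \<longleftrightarrow> (\<exists>c. x = c *\<^sub>R u)" for x
    using assms by (auto simp: norm_eq_1)
  ultimately show ?thesis
    by (auto simp: rotation_axis_def span_singleton)
qed

text \<open>A rotation commutes with the cross product, so it also fixes \<open>u \<times> v\<close>, which completes \<open>u\<close> and
  \<open>v\<close> to an orthogonal basis.\<close>

lemma rotation_fixing_two_eq_mat_1:
  fixes u v :: "real^3"
  assumes C: "rotation_matrix C" and fixed: "C *v u = u" "C *v v = v"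
    and "u \<noteq> 0" "v \<noteq> 0" "u \<bullet> v = 0"
  shows "C = mat 1"
proof -
  have fix3: "C *v cross3 u v = cross3 u v"
    using cross_rotation_matrix[OF C, of u v] fixed by simp
  define B where "B = {u, v, cross3 u v}"
  have "(norm (cross3 u v))\<^sup>2 = (norm u * norm v)\<^sup>2"
    using norm_cross_dot[of u v] assms by simp
  then have nz: "cross3 u v \<noteq> 0"
    using assms by auto
  have orth: "pairwise orthogonal B"
    using assms by (auto simp: B_def pairwise_def orthogonal_def inner_commute dot_cross_self)
  have "independent B"
    using assms nz by (intro pairwise_orthogonal_independent orth) (auto simp: B_def)
  moreover have "card B = 3"
  proof -
    have "u \<noteq> v" "u \<noteq> cross3 u v" "v \<noteq> cross3 u v"
      using assms nz dot_cross_self[of u v] by (metis inner_eq_zero_iff)+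
    then show ?thesis by (simp add: B_def)
  qed
  ultimately have "UNIV \<subseteq> span B"
    by (intro card_ge_dim_independent) auto
  then have span: "x \<in> span B" for x by blast
  have "C *v x = x" for x
  proof (rule span_induct[OF span[of x]])
    show "subspace {x. C *v x = x}"
      by (auto simp: subspace_def algebra_simps matrix_vector_mult_scaleR)
  qed (use fixed fix3 in \<open>auto simp: B_def\<close>)
  then show ?thesis by (simp add: matrix_eq)
qed

text \<open>For an involution \<open>C\<close> the vectors \<open>C x + x\<close> are fixed. If they all vanished, \<open>C\<close> would be \<open>-1\<close>,
  of determinant \<open>-1\<close> in dimension three; so there is a fixed unit vector \<open>u\<close>. For \<open>x\<close> orthogonal to
  \<open>u\<close> the fixed vector \<open>C x + x\<close> is again orthogonal to \<open>u\<close>, hence zero, as a non-trivial rotation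
  does not fix two orthogonal directions.\<close>

lemma order_two_obtains_halfturn:
  assumes "order_two C"
  obtains u where "norm u = 1" "C = halfturn u"
proof -
  have C: "rotation_matrix C" "C ** C = mat 1" "C \<noteq> mat 1"
    using assms by (auto simp: order_two_iff)
  have CC: "C *v (C *v x) = x" for x
    using C(2) by (simp add: matrix_vector_mul_assoc)
  have "\<exists>x. C *v x + x \<noteq> 0"
  proof (rule ccontr)
    assume "\<nexists>x. C *v x + x \<noteq> 0"
    then have "C *v x = - x" for x
      by (simp add: eq_neg_iff_add_eq_0)
    moreover have "(- mat 1) *v x = - x" for x :: "real^3"
      by (simp add: vec_eq_iff matrix_vector_mult_def mat_def sum_3 forall_3)
    ultimately have "C *v x = (- mat 1) *v x" for x
      by simp
    then have "C = - mat 1" by (simp add: matrix_eq)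
    then have "det C = - 1" by (simp add: det_3 mat_def)
    with C(1) show False by (simp add: rotation_matrix_def)
  qed
  then obtain x where x: "C *v x + x \<noteq> 0" by blast
  define u where "u = sgn (C *v x + x)"
  have u: "norm u = 1"
    using x by (simp add: u_def norm_sgn)
  have "C *v (C *v x + x) = C *v x + x"
    by (simp add: matrix_vector_right_distrib CC)
  then have Cu: "C *v u = u"
    by (simp add: u_def sgn_div_norm matrix_vector_mult_scaleR)
  have isometry: "(C *v y) \<bullet> (C *v z) = y \<bullet> z" for y z
    using C(1) orthogonal_transformation_matrix[of "(*v) C"]
    by (simp add: rotation_matrix_def orthogonal_transformation_def)
  have neg: "C *v y = - y" if y: "u \<bullet> y = 0" for y
  proof (rule ccontr)
    assume "C *v y \<noteq> - y"
    then have "C *v y + y \<noteq> 0" by (simp add: eq_neg_iff_add_eq_0)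
    moreover have "C *v (C *v y + y) = C *v y + y"
      by (simp add: matrix_vector_right_distrib CC)
    moreover have "u \<bullet> (C *v y + y) = 0"
      using isometry[of u y] y by (simp add: Cu inner_add_right)
    ultimately have "C = mat 1"
      using u Cu by (intro rotation_fixing_two_eq_mat_1[OF C(1), of u "C *v y + y"]) auto
    with C(3) show False ..
  qed
  have "C *v y = halfturn u *v y" for y
  proof -
    have "C *v (y - (u \<bullet> y) *\<^sub>R u) = - (y - (u \<bullet> y) *\<^sub>R u)"
      using u by (intro neg) (simp add: inner_diff_right norm_eq_1)
    then have "C *v y - (u \<bullet> y) *\<^sub>R u = - (y - (u \<bullet> y) *\<^sub>R u)"
      by (simp add: matrix_vector_mult_diff_distrib matrix_vector_mult_scaleR Cu)
    then have "C *v y = (u \<bullet> y) *\<^sub>R u + (u \<bullet> y) *\<^sub>R u - y"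
      by (simp add: algebra_simps)
    then show ?thesis
      by (simp add: halfturn_apply scaleR_2[symmetric])
  qed
  then have "C = halfturn u" by (simp add: matrix_eq)
  with u that show thesis by blast
qed

section \<open>Half-turns about the lines of a plane\<close>

locale orthonormal_pair =
  fixes e f :: "real^3"
  assumes norm_e: "norm e = 1" and norm_f: "norm f = 1" and orth: "e \<bullet> f = 0"
begin

definition w :: "real \<Rightarrow> real^3" where
  "w \<theta> = cos \<theta> *\<^sub>R e + sin \<theta> *\<^sub>R f"

definition H :: "real \<Rightarrow> real^3^3" where
  "H \<theta> = halfturn (w \<theta>)"

lemma inner_pair [simp]: "e \<bullet> e = 1" "f \<bullet> f = 1" "e \<bullet> f = 0" "f \<bullet> e = 0"
  using norm_e norm_f orth by (simp_all add: norm_eq_1 inner_commute)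

lemma norm_w [simp]: "norm (w \<theta>) = 1"
  by (simp add: w_def norm_eq_1 inner_add_left inner_add_right flip: power2_eq_square)

lemma H_square [simp]: "H \<theta> ** H \<theta> = mat 1"
  by (simp add: H_def halfturn_square)

text \<open>This is the block decomposition of the half-turn for the plane and its normal: the matrix with
  rows \<open>(cos 2\<theta>, sin 2\<theta>)\<close> and \<open>(sin 2\<theta>, -cos 2\<theta>)\<close> of a plane reflection, and \<open>-1\<close> on the last bracket,
  which is the component of \<open>x\<close> normal to the plane.\<close>

lemma H_apply:
  "H \<theta> *v x =
     (cos (2 * \<theta>) * (e \<bullet> x) + sin (2 * \<theta>) * (f \<bullet> x)) *\<^sub>R e +
     (sin (2 * \<theta>) * (e \<bullet> x) - cos (2 * \<theta>) * (f \<bullet> x)) *\<^sub>R f -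
     (x - (e \<bullet> x) *\<^sub>R e - (f \<bullet> x) *\<^sub>R f)"
proof -
  have cos2: "cos (2 * \<theta>) = 2 * cos \<theta> * cos \<theta> - 1" "cos (2 * \<theta>) = 1 - 2 * sin \<theta> * sin \<theta>"
    using cos_double_cos[of \<theta>] cos_double_sin[of \<theta>] by (simp_all add: power2_eq_square)
  have "2 * (w \<theta> \<bullet> x) * cos \<theta> = (cos (2 * \<theta>) + 1) * (e \<bullet> x) + sin (2 * \<theta>) * (f \<bullet> x)"
    unfolding sin_double cos2(1) by (simp add: w_def inner_add_left algebra_simps)
  moreover have "2 * (w \<theta> \<bullet> x) * sin \<theta> = sin (2 * \<theta>) * (e \<bullet> x) + (1 - cos (2 * \<theta>)) * (f \<bullet> x)"
    unfolding sin_double cos2(2) by (simp add: w_def inner_add_left algebra_simps)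
  moreover have "H \<theta> *v x = (2 * (w \<theta> \<bullet> x) * cos \<theta>) *\<^sub>R e + (2 * (w \<theta> \<bullet> x) * sin \<theta>) *\<^sub>R f - x"
    by (simp add: H_def halfturn_apply w_def scaleR_add_right)
  ultimately have "H \<theta> *v x =
      ((cos (2 * \<theta>) + 1) * (e \<bullet> x) + sin (2 * \<theta>) * (f \<bullet> x)) *\<^sub>R e +
      (sin (2 * \<theta>) * (e \<bullet> x) + (1 - cos (2 * \<theta>)) * (f \<bullet> x)) *\<^sub>R f - x"
    by simp
  then show ?thesis
    by (simp add: algebra_simps)
qed

lemma inner_H_apply:
  "e \<bullet> (H \<theta> *v x) = cos (2 * \<theta>) * (e \<bullet> x) + sin (2 * \<theta>) * (f \<bullet> x)"
  "f \<bullet> (H \<theta> *v x) = sin (2 * \<theta>) * (e \<bullet> x) - cos (2 * \<theta>) * (f \<bullet> x)"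
  by (simp_all add: H_apply inner_add_right inner_diff_right)

text \<open>In the plane, the product of the reflections at angles \<open>\<beta>\<close> and \<open>\<gamma>\<close> is the rotation by
  \<open>2 (\<beta> - \<gamma>)\<close>, and a rotation followed by a reflection is a reflection in a line turned by half the
  angle. On the normal, both sides are \<open>-1\<close> because the number of factors is odd.\<close>

lemma three_reflections: "H \<alpha> ** (H \<beta> ** H \<gamma>) = H (\<alpha> - \<beta> + \<gamma>)"
proof -
  have "H \<alpha> *v (H \<beta> *v (H \<gamma> *v x)) = H (\<alpha> - \<beta> + \<gamma>) *v x" for x
  proof -
    define N where "N y = y - (e \<bullet> y) *\<^sub>R e - (f \<bullet> y) *\<^sub>R f" for y :: "real^3"
    have N_H: "N (H \<theta> *v y) = - N y" for \<theta> y
      unfolding N_def inner_H_apply by (simp add: H_apply)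
    have dec: "y = z" if "e \<bullet> y = e \<bullet> z" "f \<bullet> y = f \<bullet> z" "N y = N z" for y z
      using that by (simp add: N_def)
    show ?thesis
    proof (rule dec)
      show "N (H \<alpha> *v (H \<beta> *v (H \<gamma> *v x))) = N (H (\<alpha> - \<beta> + \<gamma>) *v x)"
        by (simp add: N_H)
    qed (simp_all add: inner_H_apply cos_add sin_add cos_diff sin_diff algebra_simps)
  qed
  then show ?thesis
    by (simp add: matrix_eq matrix_vector_mul_assoc)
qed

text \<open>A half-turn determines its axis, and \<open>w \<theta>\<close> spans the same line as \<open>w 0\<close> just when it is
  \<open>\<plusminus> w 0\<close>.\<close>

lemma H_eq_H_0_iff: "H \<theta> = H 0 \<longleftrightarrow> sin \<theta> = 0"
proof
  assume "H \<theta> = H 0"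
  then have "e \<bullet> (H \<theta> *v e) = e \<bullet> (H 0 *v e)" by simp
  then have "cos (2 * \<theta>) = 1" by (simp add: inner_H_apply)
  then show "sin \<theta> = 0" by (simp add: cos_double_sin)
next
  assume "sin \<theta> = 0"
  then have "cos (2 * \<theta>) = 1" "sin (2 * \<theta>) = 0"
    by (simp_all add: cos_double_sin sin_double)
  then show "H \<theta> = H 0"
    by (simp add: matrix_eq H_apply)
qed

lemma H_add_multiple_pi: "H (\<theta> + of_int k * pi) = H \<theta>"
proof -
  have "H (\<theta> + of_int k * pi) = H \<theta> ** (H 0 ** H (of_int k * pi))"
    by (simp add: three_reflections)
  also have "H (of_int k * pi) = H 0"
    by (simp add: H_eq_H_0_iff sin_zero_iff_int2)
  finally show ?thesis by simp
qed

section \<open>The dihedral group generated by two half-turns\<close>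

lemma dihedral_rotation_pow:
  "(H 0 ** H \<phi>) [^]\<^bsub>SO3\<^esub> (n::nat) = H 0 ** H (of_nat n * \<phi>)"
proof (induction n)
  case (Suc n)
  interpret group SO3 by (rule group_SO3)
  have "(H 0 ** H \<phi>) [^]\<^bsub>SO3\<^esub> Suc n = H 0 ** (H (of_nat n * \<phi>) ** (H 0 ** H \<phi>))"
    by (simp add: Suc.IH matrix_mul_assoc)
  then show ?case
    by (simp add: three_reflections algebra_simps)
qed (simp add: H_square)

text \<open>By the law of three reflections every word in the half-turns \<open>H (k \<phi>)\<close> equals one of length one
  or two, and a word of length two can be made to begin with \<open>H 0\<close> by inserting \<open>H 0 H 0 = 1\<close>.\<close>

lemma dihedral_generate_subset:
  assumes "rotation_matrix (H 0)" "rotation_matrix (H \<phi>)"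
  shows "generate SO3 {H 0, H \<phi>} \<subseteq>
    range (\<lambda>k::int. H (of_int k * \<phi>)) \<union> range (\<lambda>k::int. H 0 ** H (of_int k * \<phi>))"
proof
  define D where "D = range (\<lambda>k::int. H (of_int k * \<phi>)) \<union> range (\<lambda>k::int. H 0 ** H (of_int k * \<phi>))"
  define r where "r k = H (of_int k * \<phi>)" for k :: int
  have rrr: "r i ** (r j ** r k) = r (i - j + k)" for i j k
    by (simp add: r_def three_reflections algebra_simps)
  have rrr': "r i ** r j ** r k = r (i - j + k)" for i j k
    using rrr by (simp add: matrix_mul_assoc)
  have D_eq: "D = range r \<union> range (\<lambda>k. r 0 ** r k)"
    by (simp add: D_def r_def)
  have DI: "r k \<in> D" "r i ** r j \<in> D" for i j k
  proof -
    show "r k \<in> D" by (simp add: D_eq)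
    have "r i ** r j = r 0 ** (r 0 ** r i ** r j)"
      by (simp add: r_def matrix_mul_assoc)
    then show "r i ** r j \<in> D" by (simp add: rrr' D_eq)
  qed
  fix g assume "g \<in> generate SO3 {H 0, H \<phi>}"
  then have "g \<in> D"
  proof induction
    case one
    show ?case using DI(2)[of 0 0] by (simp add: r_def)
  next
    case (incl h)
    then show ?case using DI(1)[of 0] DI(1)[of 1] by (auto simp: r_def)
  next
    case (inv h)
    then have "inv\<^bsub>SO3\<^esub> h = h"
      using assms by (auto intro!: SO3_inv_involution)
    with inv show ?case using DI(1)[of 0] DI(1)[of 1] by (auto simp: r_def)
  next
    case (eng g h)
    have four: "r 0 ** r i ** (r 0 ** r j) = r (- i) ** r j" for i j
      by (simp add: matrix_mul_assoc rrr')
    obtain i j where "g = r i \<or> g = r 0 ** r i" "h = r j \<or> h = r 0 ** r j"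
      using eng.IH by (auto simp: D_eq)
    then show ?case
      using DI by (elim disjE) (simp_all add: rrr rrr' four)
  qed
  then show "g \<in> range (\<lambda>k::int. H (of_int k * \<phi>)) \<union> range (\<lambda>k::int. H 0 ** H (of_int k * \<phi>))"
    by (simp add: D_def)
qed

text \<open>If \<open>b \<phi>\<close> is an integral multiple of the period \<open>\<pi>\<close>, then \<open>H (k \<phi>)\<close> depends on \<open>k\<close> modulo \<open>b\<close>
  only.\<close>

lemma finite_dihedral:
  assumes "rotation_matrix (H 0)" "rotation_matrix (H \<phi>)" and "\<phi> = of_rat q * pi"
  shows "finite (generate SO3 {H 0, H \<phi>})"
proof -
  obtain a b :: int where q: "q = of_int a / of_int b" "b > 0"
    by (metis Fract_of_int_quotient Rat_cases)
  have b\<phi>: "of_int b * \<phi> = of_int a * pi"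
    using q assms(3) by (simp add: of_rat_divide)
  have "H (of_int k * \<phi>) \<in> (\<lambda>k. H (of_int k * \<phi>)) ` {0..<b}" for k
  proof -
    have "of_int k = (of_int (k mod b) + of_int (k div b) * of_int b :: real)"
      by (metis mod_div_mult_eq of_int_add of_int_mult)
    then have "of_int k * \<phi> = of_int (k mod b) * \<phi> + of_int (k div b) * (of_int b * \<phi>)"
      by (simp add: algebra_simps)
    also have "\<dots> = of_int (k mod b) * \<phi> + of_int (k div b * a) * pi"
      by (simp add: b\<phi>)
    finally have "H (of_int k * \<phi>) = H (of_int (k mod b) * \<phi>)"
      by (simp only: H_add_multiple_pi)
    moreover have "k mod b \<in> {0..<b}" using q(2) by simp
    ultimately show ?thesis by blast
  qed
  then have fin: "finite (range (\<lambda>k::int. H (of_int k * \<phi>)))"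
    by (meson finite_atLeastLessThan_int finite_imageI finite_subset image_subsetI)
  have "range (\<lambda>k::int. H 0 ** H (of_int k * \<phi>)) = (**) (H 0) ` range (\<lambda>k::int. H (of_int k * \<phi>))"
    by auto
  with fin show ?thesis
    by (intro finite_subset[OF dihedral_generate_subset[OF assms(1,2)]]) simp
qed

text \<open>If the power of exponent \<open>n > 0\<close> is trivial, then \<open>H (n \<phi>) = H 0\<close>, so \<open>n \<phi>\<close> is an integral
  multiple of \<open>\<pi>\<close>.\<close>

lemma dihedral_rotation_infinite_order:
  assumes "rotation_matrix (H 0 ** H \<phi>)" and "\<phi> = \<psi> * pi" "\<psi> \<notin> \<rat>"
  shows "infinite_order (H 0 ** H \<phi>)"
proof -
  have "H 0 ** H (of_nat n * \<phi>) \<noteq> mat 1" if "n > 0" for n :: nat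
  proof
    assume "H 0 ** H (of_nat n * \<phi>) = mat 1"
    then have "H 0 ** H 0 ** H (of_nat n * \<phi>) = H 0"
      by (metis matrix_mul_assoc matrix_mul_rid)
    then have "sin (of_nat n * \<phi>) = 0"
      by (simp add: H_eq_H_0_iff)
    then obtain k :: int where "of_nat n * (\<psi> * pi) = of_int k * pi"
      using assms(2) by (auto simp: sin_zero_iff_int2)
    then have "\<psi> = of_int k / of_nat n"
      using that by (simp add: field_simps)
    then show False using assms(3) by simp
  qed
  then show ?thesis
    using assms(1) by (auto simp: infinite_order_def dihedral_rotation_pow)
qed

text \<open>A vector fixed by \<open>H 0 H \<phi>\<close> has the same image under \<open>H \<phi>\<close> and \<open>H 0\<close>. Added to the vector, these
  images are multiples of \<open>w \<phi>\<close> and \<open>w 0\<close>, which are independent, so that both multiples vanish.\<close>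

lemma dihedral_orthogonal_axes:
  assumes "sin \<phi> \<noteq> 0"
  shows "orthogonal_axes (H 0) (H 0 ** H \<phi>)"
  unfolding orthogonal_axes_def
proof (intro ballI)
  fix x y assume x: "x \<in> rotation_axis (H 0)" and y: "y \<in> rotation_axis (H 0 ** H \<phi>)"
  have "H 0 *v (H \<phi> *v y) = y"
    using y by (simp add: rotation_axis_def matrix_vector_mul_assoc)
  then have "H \<phi> *v y = H 0 *v y"
    by (metis H_square matrix_vector_mul_assoc matrix_vector_mul_lid)
  then have eq: "(w \<phi> \<bullet> y) *\<^sub>R w \<phi> = (e \<bullet> y) *\<^sub>R e"
    by (simp add: H_def halfturn_apply w_def[of 0] flip: scaleR_scaleR)
  have "f \<bullet> ((w \<phi> \<bullet> y) *\<^sub>R w \<phi>) = f \<bullet> ((e \<bullet> y) *\<^sub>R e)"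
    by (simp only: eq)
  then have "w \<phi> \<bullet> y = 0"
    using assms by (simp add: w_def[of \<phi>] inner_add_right)
  with eq have "e \<bullet> y = 0" using norm_e by auto
  moreover obtain c where "x = c *\<^sub>R e"
    using x rotation_axis_halfturn[of "w 0"] by (auto simp: H_def w_def span_singleton norm_e)
  ultimately show "orthogonal x y" by (simp add: orthogonal_def)
qed

text \<open>Every element of the group is \<open>\<plusminus>1\<close> on the normal of the plane, and so is every rotation in its
  closure. A rotation that tilts the normal into the plane is therefore not a limit of group
  elements.\<close>

lemma not_dense_dihedral:
  assumes rot: "rotation_matrix (H 0)" "rotation_matrix (H \<phi>)"
  shows "\<not> dense_in_SO3 (generate SO3 {H 0, H \<phi>})"
proof
  assume dense: "dense_in_SO3 (generate SO3 {H 0, H \<phi>})"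
  define n where "n = cross3 e f"
  have "(norm n)\<^sup>2 = 1"
    using norm_cross_dot[of e f] norm_e norm_f by (simp add: n_def)
  then have n: "norm n = 1" by (simp add: power2_eq_square norm_eq_1 flip: power2_norm_eq_inner)
  have n_orth: "e \<bullet> n = 0" "f \<bullet> n = 0"
    by (simp_all add: n_def dot_cross_self)
  have Hn: "H \<theta> *v n = - n" for \<theta>
    by (simp add: H_apply n_orth)
  have HHn: "H 0 ** H \<theta> *v n = n" for \<theta>
    using Hn matrix_vector_mult_scaleR[of "H 0" "- 1" n] by (simp flip: matrix_vector_mul_assoc)
  define S where "S = {A :: real^3^3. A *v n = n \<or> A *v n = - n}"
  have "generate SO3 {H 0, H \<phi>} \<subseteq> S"
    using dihedral_generate_subset[OF rot]
    by (fastforce simp: S_def Hn HHn)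
  moreover have "closed S"
  proof -
    have cont: "continuous_on UNIV (\<lambda>A :: real^3^3. A *v n)"
      by (simp add: matrix_vector_mult_def) (intro continuous_intros)
    have "closed {A :: real^3^3. A *v n = n}" "closed {A :: real^3^3. A *v n = - n}"
      by (intro closed_Collect_eq cont continuous_intros)+
    then show ?thesis by (simp add: S_def Collect_disj_eq closed_Un)
  qed
  ultimately have sub: "carrier SO3 \<subseteq> S"
    using dense closure_minimal unfolding dense_in_SO3_def by blast
  obtain g where g: "orthogonal_transformation g" "det (matrix g) = 1" "g n = e"
    using rotation_exists_1[of n e] n norm_e by auto
  then have "matrix g \<in> carrier SO3"
    by (simp add: rotation_matrix_def orthogonal_transformation_matrix)
  with sub have "matrix g \<in> S" by blast
  moreover have "matrix g *v n = e"
    using g by (simp add: matrix_works orthogonal_transformation_linear)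
  ultimately have "e = n \<or> e = - n" by (simp add: S_def)
  then show False using n_orth(1) n by (auto simp: norm_eq_1)
qed

end

section \<open>The holonomy group of two half-turns\<close>

text \<open>As \<open>v\<close> and \<open>-v\<close> define the same half-turn, the sign of \<open>v\<close> can be chosen so that \<open>v\<close> makes the
  angle \<open>\<phi> \<le> \<pi>/2\<close> with \<open>u\<close>. This angle is not zero, since otherwise the half-turns would coincide and
  hence commute. The Gram--Schmidt process then produces the second vector \<open>f\<close> of the plane, and \<open>v\<close>
  lies at angle \<open>\<phi>\<close> in the direction of \<open>f\<close>.\<close>

lemma halfturn_pair_obtains_orthonormal_pair:
  assumes u: "norm u = 1" and v: "norm v = 1"
    and nc: "halfturn u ** halfturn v \<noteq> halfturn v ** halfturn u"
  defines "\<phi> \<equiv> arccos \<bar>u \<bullet> v\<bar>"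
  obtains f where "orthonormal_pair u f" "halfturn u = orthonormal_pair.H u f 0"
    "halfturn v = orthonormal_pair.H u f \<phi>" "sin \<phi> \<noteq> 0"
proof -
  define v' where "v' = (if u \<bullet> v < 0 then - v else v)"
  have v': "norm v' = 1" "halfturn v' = halfturn v" "u \<bullet> v' = \<bar>u \<bullet> v\<bar>"
    using v by (auto simp: v'_def)
  have le: "\<bar>u \<bullet> v\<bar> \<le> 1"
    using Cauchy_Schwarz_ineq2[of u v] u v by simp
  then have cos: "cos \<phi> = u \<bullet> v'"
    by (simp add: \<phi>_def v'(3))
  have "u \<noteq> v'"
    using nc v'(2) by auto
  then have "u \<bullet> v' \<noteq> 1"
    using u v'(1) norm_eq_sqrt_inner[of "u - v'"]
    by (auto simp: norm_eq_1 inner_diff_left inner_diff_right inner_commute[of v' u])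
  then have s: "sin \<phi> \<noteq> 0"
    using le v'(3) sin_arccos_nonzero[of "\<bar>u \<bullet> v\<bar>"] by (simp add: \<phi>_def)
  define f where "f = (1 / sin \<phi>) *\<^sub>R (v' - cos \<phi> *\<^sub>R u)"
  have "(v' - cos \<phi> *\<^sub>R u) \<bullet> (v' - cos \<phi> *\<^sub>R u) = 1 - (cos \<phi>)\<^sup>2"
    using u v'(1)
    by (simp add: norm_eq_1 inner_diff_left inner_diff_right cos[symmetric] inner_commute[of v' u]
        power2_eq_square)
  then have "f \<bullet> f = 1"
    using s by (simp add: f_def flip: sin_squared_eq) (simp add: power2_eq_square)
  moreover have "u \<bullet> f = 0"
    using u by (simp add: f_def inner_diff_right norm_eq_1 cos)
  ultimately interpret orthonormal_pair u f
    using u by unfold_locales (simp_all add: norm_eq_1)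
  have "w \<phi> = v'" unfolding w_def using s by (simp add: f_def)
  then have "H \<phi> = halfturn v" by (simp add: H_def v')
  moreover have "H 0 = halfturn u" by (simp add: H_def w_def)
  ultimately show thesis
    using that[of f] orthonormal_pair_axioms s by simp
qed

theorem proposition5p2:
  fixes E :: "torus \<Rightarrow> 'v::real_vector set"
    and \<A> :: "'v chart set"
    and h :: "torus \<Rightarrow> 'v \<Rightarrow> 'v \<Rightarrow> real"
    and nabla :: "(torus \<Rightarrow> real \<times> real) \<Rightarrow> (torus \<Rightarrow> 'v) \<Rightarrow> (torus \<Rightarrow> 'v)"
    and nabla_hat :: "(torus \<Rightarrow> real \<times> real) \<Rightarrow> (torus \<Rightarrow> 'v bivector) \<Rightarrow> (torus \<Rightarrow> 'v bivector)"
    and \<epsilon> :: real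
    and \<omega> :: "'v bivector^3"
    and C\<^sub>1 C\<^sub>2 :: "real^3^3"
    and \<phi> :: real
  assumes "oriented_vector_bundle E \<A>"
    and "bundle_metric E \<A> h"
    and "h_connection E \<A> h nabla"
    and "ext2_connection E \<A> nabla nabla_hat"
    and "\<epsilon> \<in> {1, - 1}"
    and "pos_orthonormal_ext2_basis \<epsilon> E \<A> h (pr (0, 0)) \<omega>"
    and "holonomy_generators \<epsilon> E \<A> h nabla_hat \<omega> C\<^sub>1 C\<^sub>2"
    and "order_two C\<^sub>1" and "order_two C\<^sub>2"
    and "C\<^sub>1 \<otimes>\<^bsub>SO3\<^esub> C\<^sub>2 \<noteq> C\<^sub>2 \<otimes>\<^bsub>SO3\<^esub> C\<^sub>1"
    and "\<phi> = line_angle (rotation_axis C\<^sub>1) (rotation_axis C\<^sub>2)"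
  shows "(\<phi> \<in> {0<..<pi / 2} \<and> (\<exists>q::rat. \<phi> = of_rat q * pi) \<longrightarrow>
            finite (holonomy_group C\<^sub>1 C\<^sub>2)) \<and>
         ((\<exists>\<psi>. \<psi> \<notin> \<rat> \<and> \<phi> = \<psi> * pi) \<longrightarrow>
            (\<exists>A B. order_two A \<and> infinite_order B \<and> orthogonal_axes A B \<and>
               conjugate_in_SO3 (holonomy_group C\<^sub>1 C\<^sub>2) (generate SO3 {A, B})) \<and>
            infinite (holonomy_group C\<^sub>1 C\<^sub>2) \<and>
            \<not> dense_in_SO3 (holonomy_group C\<^sub>1 C\<^sub>2))"
proof -
  have rot: "rotation_matrix C\<^sub>1" "rotation_matrix C\<^sub>2"
    using assms(8,9) by (simp_all add: order_two_iff)
  obtain u where u: "norm u = 1" "C\<^sub>1 = halfturn u"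
    using assms(8) by (rule order_two_obtains_halfturn)
  obtain v where v: "norm v = 1" "C\<^sub>2 = halfturn v"
    using assms(9) by (rule order_two_obtains_halfturn)
  have "u \<noteq> 0" "v \<noteq> 0" using u v by auto
  then have \<phi>: "\<phi> = arccos \<bar>u \<bullet> v\<bar>"
    using assms(11) u v by (simp add: rotation_axis_halfturn line_angle_span)
  have "halfturn u ** halfturn v \<noteq> halfturn v ** halfturn u"
    using assms(10) u v by simp
  then obtain f where "orthonormal_pair u f" and C1: "C\<^sub>1 = orthonormal_pair.H u f 0"
    and C2: "C\<^sub>2 = orthonormal_pair.H u f \<phi>" and s: "sin \<phi> \<noteq> 0"
    using halfturn_pair_obtains_orthonormal_pair[OF u(1) v(1)] u(2) v(2) \<phi> by metis
  interpret orthonormal_pair u f by fact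
  note HC = C1[symmetric] C2[symmetric]
  have sub: "{C\<^sub>1, C\<^sub>2} \<subseteq> carrier SO3"
    using rot by simp
  have B: "rotation_matrix (C\<^sub>1 ** C\<^sub>2)"
    using rot by (rule rotation_matrix_mult)
  have gen: "generate SO3 {C\<^sub>1, C\<^sub>1 ** C\<^sub>2} = holonomy_group C\<^sub>1 C\<^sub>2"
    using rot by (simp add: holonomy_group_def generate_SO3_product_generator)
  show ?thesis
  proof (intro conjI impI)
    assume "\<phi> \<in> {0<..<pi / 2} \<and> (\<exists>q::rat. \<phi> = of_rat q * pi)"
    then obtain q :: rat where "\<phi> = of_rat q * pi" by blast
    then show "finite (holonomy_group C\<^sub>1 C\<^sub>2)"
      unfolding holonomy_group_def by (rule finite_dihedral[of \<phi> q, unfolded HC, OF rot])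
  next
    assume "\<exists>\<psi>. \<psi> \<notin> \<rat> \<and> \<phi> = \<psi> * pi"
    then obtain \<psi> where \<psi>: "\<phi> = \<psi> * pi" "\<psi> \<notin> \<rat>" by blast
    then have inf: "infinite_order (C\<^sub>1 ** C\<^sub>2)"
      by (rule dihedral_rotation_infinite_order[of \<phi> \<psi>, unfolded HC, OF B])
    have "C\<^sub>1 ** C\<^sub>2 \<in> generate SO3 {C\<^sub>1, C\<^sub>2}"
      unfolding gen[unfolded holonomy_group_def, symmetric] by (auto intro: generate.incl)
    then show "infinite (holonomy_group C\<^sub>1 C\<^sub>2)"
      unfolding holonomy_group_def by (rule infinite_generate_infinite_order[OF inf _ sub])
    have "holonomy_group C\<^sub>1 C\<^sub>2 \<subseteq> carrier SO3"
      unfolding holonomy_group_def using sub by (rule group.generate_incl[OF group_SO3])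
    then have "conjugate_in_SO3 (holonomy_group C\<^sub>1 C\<^sub>2) (generate SO3 {C\<^sub>1, C\<^sub>1 ** C\<^sub>2})"
      unfolding gen by (rule conjugate_in_SO3_refl)
    moreover have "orthogonal_axes C\<^sub>1 (C\<^sub>1 ** C\<^sub>2)"
      using dihedral_orthogonal_axes[OF s] by (simp add: HC)
    ultimately show "\<exists>A B. order_two A \<and> infinite_order B \<and> orthogonal_axes A B \<and>
        conjugate_in_SO3 (holonomy_group C\<^sub>1 C\<^sub>2) (generate SO3 {A, B})"
      using assms(8) inf by blast
    show "\<not> dense_in_SO3 (holonomy_group C\<^sub>1 C\<^sub>2)"
      using not_dense_dihedral[of \<phi>] rot by (simp add: HC holonomy_group_def)
  qed
qed

end
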